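(* There exists a filter $\mathcal{F}$ on $\omega$ which is non-meager (as a subset of $\mathcal{P}(\omega)$) and which, with the subspace topology inherited from $\mathcal{P}(\omega)$, is not CDH.
   Context: The statement is asserted in ZFC, with no additional set-theoretic assumptions. A filter on a countable set $C$ always means a free filter, i.e., a filter containing all cofinite subsets of $C$. The power set $\mathcal{P}(\omega)$ is identified with $2^\omega$ via characteristic functions and carries the product (Cantor set) topology; filters on $\omega$ carry the subspace topology inherited from $\mathcal{P}(\omega)$. A topological space $X$ is CDH (countable dense homogeneous) if for arbitrary countable dense subsets $D_0, D_1$ of $X$ there exists a homeomorphism $\phi: X \to X$ such that $\phi[D_0]=D_1$. *)

theory Defs
  imports "HOL-Analysis.Analysis"
begin

(* Sets of naturals are identified with their characteristic functions. *)
definition powerset_topology :: "nat set topology" where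
  "powerset_topology =
     pullback_topology UNIV (\<lambda>A n. n \<in> A)
       (product_topology (\<lambda>_::nat. discrete_topology (UNIV :: bool set)) UNIV)"

lemma topspace_powerset_topology [simp]: "topspace powerset_topology = UNIV"
  by (simp add: powerset_topology_def topspace_pullback_topology PiE_UNIV_domain)

(* The filter regarded as a family of subsets. *)
definition filter_sets :: "'a filter \<Rightarrow> 'a set set" where
  "filter_sets F = {A. eventually (\<lambda>x. x \<in> A) F}"

(* The properness condition excludes the library's improper filter bot, whose family of
   sets is the whole power set. *)
definition free_filter :: "'a filter \<Rightarrow> bool" where
  "free_filter F \<longleftrightarrow> F \<noteq> bot \<and> (\<forall>A. finite (- A) \<longrightarrow> A \<in> filter_sets F)"

definition nowhere_dense_in :: "'a topology \<Rightarrow> 'a set \<Rightarrow> bool" where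
  "nowhere_dense_in X S \<longleftrightarrow> S \<subseteq> topspace X \<and> X interior_of (X closure_of S) = {}"

definition meager_in :: "'a topology \<Rightarrow> 'a set \<Rightarrow> bool" where
  "meager_in X S \<longleftrightarrow>
     (\<exists>N :: nat \<Rightarrow> 'a set. (\<forall>n. nowhere_dense_in X (N n)) \<and> S = (\<Union>n. N n))"

definition countable_dense_in :: "'a topology \<Rightarrow> 'a set \<Rightarrow> bool" where
  "countable_dense_in X D \<longleftrightarrow>
     countable D \<and> D \<subseteq> topspace X \<and> X closure_of D = topspace X"

definition CDH_space :: "'a topology \<Rightarrow> bool" where
  "CDH_space X \<longleftrightarrow>
     (\<forall>D0 D1. countable_dense_in X D0 \<and> countable_dense_in X D1 \<longrightarrow>
        (\<exists>\<phi>. homeomorphic_map X X \<phi> \<and> \<phi> ` D0 = D1))"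

end

(*
  Fix a free ultrafilter U, and let F consist of the subsets of omega x omega (coded by the
  pairing function) whose n-th section lies in U for all but finitely many n. This filter is
  non-meager by the Talagrand-style criterion that every interval partition has infinitely many
  intervals missed by a common member. The sets y x omega with y cofinite form a
  countable, crowded, closed subset of F. On the other hand, in any filter satisfying the
  criterion, the dense set of cofinite sets contains no nonempty crowded subset that is closed in
  the filter: moving between its points only inside intervals missed by a member of the
  filter produces a limit which is in the filter but not cofinite. Hence no homeomorphism maps
  the cofinite sets together with the sets y x omega onto the cofinite sets.
*)
theory Submission
  imports Defs
begin

section \<open>Cylinders\<close>

lemma Int_eq_Int_subset: "\<lbrakk>A \<inter> T = B \<inter> T; S \<subseteq> T\<rbrakk> \<Longrightarrow> A \<inter> S = B \<inter> S"
  by blast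

text \<open>A basic open set of the product restricts finitely many coordinates, all below some
  \<open>n\<close>. From here on topology is handled through agreement on initial segments.\<close>

lemma openin_powerset_topology:
  "openin powerset_topology S \<longleftrightarrow>
     (\<forall>A\<in>S. \<exists>n. \<forall>B. B \<inter> {..<n} = A \<inter> {..<n} \<longrightarrow> B \<in> S)"
  (is "?L \<longleftrightarrow> ?R")
proof
  assume ?L
  then obtain T where T: "openin (product_topology (\<lambda>_::nat. discrete_topology (UNIV :: bool set)) UNIV) T"
    and S: "S = (\<lambda>A n. n \<in> A) -` T"
    by (auto simp: powerset_topology_def openin_pullback_topology)
  show ?R
  proof
    fix A assume "A \<in> S"
    with S T obtain W where W: "finite {i. W i \<noteq> (UNIV :: bool set)}"
      "(\<lambda>n. n \<in> A) \<in> Pi\<^sub>E UNIV W" "Pi\<^sub>E UNIV W \<subseteq> T"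
      by (force simp: openin_product_topology_alt)
    obtain n where n: "\<And>i. W i \<noteq> UNIV \<Longrightarrow> i < n"
      using W(1) by (auto simp: finite_nat_set_iff_bounded)
    have "B \<in> S" if "B \<inter> {..<n} = A \<inter> {..<n}" for B
    proof -
      have "(i \<in> B) \<in> W i" for i
      proof (cases "i < n")
        case True
        then have "i \<in> B \<longleftrightarrow> i \<in> A" using that by auto
        then show ?thesis using W(2) by (auto simp: PiE_iff)
      qed (use n in auto)
      then show ?thesis using W(3) S by (auto simp: PiE_UNIV_domain)
    qed
    then show "\<exists>n. \<forall>B. B \<inter> {..<n} = A \<inter> {..<n} \<longrightarrow> B \<in> S" by blast
  qed
next
  assume R: ?R
  have cylinder: "openin powerset_topology {B. B \<inter> {..<n} = A \<inter> {..<n}}" for A and n :: nat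
  proof -
    define W where "W i = (if i < n then {i \<in> A} else UNIV)" for i
    have "finite {i. W i \<noteq> UNIV}"
      by (rule finite_subset[of _ "{..<n}"]) (auto simp: W_def)
    then have "openin (product_topology (\<lambda>_::nat. discrete_topology (UNIV :: bool set)) UNIV)
        (Pi\<^sub>E UNIV W)"
      by (intro product_topology_basis) auto
    moreover have "{B. B \<inter> {..<n} = A \<inter> {..<n}} = (\<lambda>A n. n \<in> A) -` Pi\<^sub>E UNIV W"
      by (auto simp: W_def PiE_UNIV_domain Pi_iff split: if_splits)
    ultimately show ?thesis
      by (auto simp: powerset_topology_def openin_pullback_topology)
  qed
  show ?L
  proof (subst openin_subopen, intro ballI)
    fix A assume "A \<in> S"
    with R obtain n where "\<forall>B. B \<inter> {..<n} = A \<inter> {..<n} \<longrightarrow> B \<in> S" by blast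
    then show "\<exists>T. openin powerset_topology T \<and> A \<in> T \<and> T \<subseteq> S"
      using cylinder[of n A] by blast
  qed
qed

lemma in_closure_of_subtopology_powerset:
  "A \<in> subtopology powerset_topology \<F> closure_of S \<longleftrightarrow>
     A \<in> \<F> \<and> (\<forall>n. \<exists>B\<in>S \<inter> \<F>. B \<inter> {..<n} = A \<inter> {..<n})" (is "?L \<longleftrightarrow> ?R")
proof
  assume L: ?L
  have "\<exists>B\<in>S \<inter> \<F>. B \<inter> {..<n} = A \<inter> {..<n}" for n
  proof -
    let ?C = "{B. B \<inter> {..<n} = A \<inter> {..<n}}"
    have "openin powerset_topology ?C"
      unfolding openin_powerset_topology by blast
    then have "openin (subtopology powerset_topology \<F>) (\<F> \<inter> ?C)"
      by (rule openin_subtopology_Int2)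
    moreover have "A \<in> \<F> \<inter> ?C" using L by (simp add: in_closure_of)
    moreover have "\<forall>T. A \<in> T \<and> openin (subtopology powerset_topology \<F>) T \<longrightarrow> (\<exists>B. B \<in> S \<and> B \<in> T)"
      using L unfolding in_closure_of by (rule conjunct2)
    ultimately have "\<exists>B. B \<in> S \<and> B \<in> \<F> \<inter> ?C"
      by (metis (no_types))
    then show ?thesis by blast
  qed
  with L show ?R by (auto simp: in_closure_of)
next
  assume R: ?R
  have "\<exists>B. B \<in> S \<and> B \<in> T"
    if T: "A \<in> T" "openin (subtopology powerset_topology \<F>) T" for T
  proof -
    obtain T' where T': "openin powerset_topology T'" "T = T' \<inter> \<F>"
      using T(2) unfolding openin_subtopology by blast
    then obtain n where "\<And>B. B \<inter> {..<n} = A \<inter> {..<n} \<Longrightarrow> B \<in> T'"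
      using T(1) unfolding openin_powerset_topology by blast
    with R T'(2) show ?thesis by blast
  qed
  with R show ?L by (simp add: in_closure_of)
qed

text \<open>\<open>A\<close> is a limit point of \<open>S\<close> iff it lies in the closure of
  \<open>S - {A}\<close>, so the closure criterion carries over.\<close>

lemma in_derived_set_of_subtopology_powerset:
  "A \<in> subtopology powerset_topology \<F> derived_set_of S \<longleftrightarrow>
     A \<in> \<F> \<and> (\<forall>n. \<exists>B\<in>S \<inter> \<F>. B \<noteq> A \<and> B \<inter> {..<n} = A \<inter> {..<n})"
proof -
  have "A \<in> subtopology powerset_topology \<F> derived_set_of S \<longleftrightarrow>
      A \<in> subtopology powerset_topology \<F> closure_of (S - {A})"
    by (auto simp: in_derived_set_of in_closure_of)
  then show ?thesis
    unfolding in_closure_of_subtopology_powerset by blast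
qed

section \<open>Families missing infinitely many intervals of every partition\<close>

text \<open>The combinatorial condition from Talagrand's characterization of non-meager filters. The
  intervals start at \<open>k 0\<close>; numbers below it belong to none of them.\<close>

definition misses_intervals :: "nat set set \<Rightarrow> bool" where
  "misses_intervals \<F> \<longleftrightarrow>
     (\<forall>k :: nat \<Rightarrow> nat. strict_mono k \<longrightarrow> (\<exists>A\<in>\<F>. infinite {i. A \<inter> {k i..<k (Suc i)} = {}}))"

lemma strict_mono_between:
  fixes k :: "nat \<Rightarrow> nat"
  assumes "strict_mono k" "k 0 \<le> n"
  obtains i where "k i \<le> n" "n < k (Suc i)"
proof -
  have ex: "n < k (Suc n)"
    using strict_mono_imp_increasing[OF assms(1), of "Suc n"] by simp
  define j where "j = (LEAST i. n < k (Suc i))"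
  have "n < k (Suc j)" unfolding j_def by (rule LeastI[of _ n]) (rule ex)
  moreover have "k j \<le> n"
  proof (cases j)
    case (Suc i)
    then have "\<not> n < k (Suc i)" using not_less_Least[of i "\<lambda>i. n < k (Suc i)"] unfolding j_def by simp
    with Suc show ?thesis by simp
  qed (use assms in simp)
  ultimately show ?thesis using that by blast
qed

section \<open>Non-meagerness from missed intervals\<close>

text \<open>The cylinder of \<open>s\<close> below \<open>n\<close> is open and nonempty, so it has
  a point \<open>u\<close> outside the closure of \<open>N\<close>, and a whole cylinder around
  \<open>u\<close> avoids \<open>N\<close>.\<close>

lemma nowhere_dense_cylinder:
  assumes "nowhere_dense_in powerset_topology N"
  obtains u m where "n \<le> m" "u \<inter> {..<n} = s \<inter> {..<n}"
    "\<And>A. A \<inter> {..<m} = u \<inter> {..<m} \<Longrightarrow> A \<notin> N"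
proof -
  let ?X = powerset_topology
  let ?C = "{A. A \<inter> {..<n} = s \<inter> {..<n}}"
  have "openin ?X ?C" unfolding openin_powerset_topology by blast
  moreover have "s \<in> ?C" by simp
  ultimately have "\<not> ?C \<subseteq> ?X closure_of N"
    using assms unfolding nowhere_dense_in_def by (metis empty_iff interior_of_maximal subsetD)
  then obtain u where u: "u \<in> ?C" "u \<notin> ?X closure_of N" by blast
  then obtain T where T: "openin ?X T" "u \<in> T" "T \<inter> N = {}"
    by (auto simp: in_closure_of)
  then obtain m where m: "\<And>A. A \<inter> {..<m} = u \<inter> {..<m} \<Longrightarrow> A \<in> T"
    unfolding openin_powerset_topology by blast
  show ?thesis
  proof (rule that[of "max n m" u])
    fix A assume "A \<inter> {..<max n m} = u \<inter> {..<max n m}"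
    then have "A \<inter> {..<m} = u \<inter> {..<m}"
      by (rule Int_eq_Int_subset) simp
    then show "A \<notin> N" using m T by blast
  qed (use u in auto)
qed

text \<open>Only finitely many pairs of a past \<open>s\<close> below \<open>n\<close> and an index
  \<open>j \<le> n\<close> occur, so one pattern \<open>t\<close> can be lengthened pair by pair
  until it handles all of them.\<close>

lemma nowhere_dense_uniform_block:
  fixes N :: "nat \<Rightarrow> nat set set"
  assumes N: "\<And>j. nowhere_dense_in powerset_topology (N j)"
  shows "\<exists>m t. n < m \<and> t \<subseteq> {n..<m} \<and> (\<forall>j\<le>n. \<forall>A. A \<inter> {n..<m} = t \<longrightarrow> A \<notin> N j)"
proof -
  have "\<exists>m t. n < m \<and> t \<subseteq> {n..<m} \<and>
      (\<forall>(s, j)\<in>P. \<forall>A. A \<inter> {..<n} = s \<longrightarrow> A \<inter> {n..<m} = t \<longrightarrow> A \<notin> N j)"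
    if "finite P" "\<forall>(s, j)\<in>P. s \<subseteq> {..<n}" for P :: "(nat set \<times> nat) set"
    using that
  proof (induction rule: finite_induct)
    case empty
    then show ?case by (intro exI[of _ "Suc n"] exI[of _ "{}"]) auto
  next
    case (insert p P)
    then obtain m t where mt: "n < m" "t \<subseteq> {n..<m}"
      "\<forall>(s, j)\<in>P. \<forall>A. A \<inter> {..<n} = s \<longrightarrow> A \<inter> {n..<m} = t \<longrightarrow> A \<notin> N j"
      by auto
    obtain s j where p: "p = (s, j)" "s \<subseteq> {..<n}" using insert.prems by auto
    \<comment> \<open>Starting from \<open>s \<union> t\<close>, the extension keeps the old pattern
      on \<open>{n..<m}\<close>, so the pairs in \<open>P\<close> stay handled while the new pair is
      taken care of.\<close>
    obtain u m' where u: "m \<le> m'" "u \<inter> {..<m} = (s \<union> t) \<inter> {..<m}"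
      "\<And>A. A \<inter> {..<m'} = u \<inter> {..<m'} \<Longrightarrow> A \<notin> N j"
      using nowhere_dense_cylinder[OF N, of m "s \<union> t" j] by metis
    have "u \<inter> {..<n} = (s \<union> t) \<inter> {..<n}"
      by (rule Int_eq_Int_subset[OF u(2)]) (use mt(1) in auto)
    also have "\<dots> = s" using mt(2) p(2) by fastforce
    finally have u_low: "u \<inter> {..<n} = s" .
    have "u \<inter> {n..<m} = (s \<union> t) \<inter> {n..<m}"
      by (rule Int_eq_Int_subset[OF u(2)]) auto
    also have "\<dots> = t" using mt(2) p(2) by fastforce
    finally have u_mid: "u \<inter> {n..<m} = t" .
    have "A \<notin> N j'"
      if *: "(s', j') \<in> insert p P" "A \<inter> {..<n} = s'" "A \<inter> {n..<m'} = u \<inter> {n..<m'}" for s' j' A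
    proof
      assume A: "A \<in> N j'"
      have "A \<inter> {n..<m} = u \<inter> {n..<m}"
        by (rule Int_eq_Int_subset[OF *(3)]) (use u(1) in auto)
      then have "(s', j') \<notin> P" using mt(3) A *(2) u_mid by blast
      then have j': "j' = j" "A \<inter> {..<n} = u \<inter> {..<n}"
        using * p(1) u_low by auto
      have "{..<m'} = {..<n} \<union> {n..<m'}" using mt(1) u(1) by auto
      then have "A \<inter> {..<m'} = u \<inter> {..<m'}" using *(3) j'(2) by (simp add: Int_Un_distrib)
      then show False using u(3) A j'(1) by blast
    qed
    moreover have "n < m'" using mt(1) u(1) by simp
    ultimately show ?case
      by (intro exI[of _ m'] exI[of _ "u \<inter> {n..<m'}"]) blast
  qed
  from this[of "Pow {..<n} \<times> {..n}"] obtain m t where "n < m" "t \<subseteq> {n..<m}"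
    "\<forall>(s, j)\<in>Pow {..<n} \<times> {..n}. \<forall>A. A \<inter> {..<n} = s \<longrightarrow> A \<inter> {n..<m} = t \<longrightarrow> A \<notin> N j"
    by auto
  then show ?thesis by (intro exI[of _ m] exI[of _ t]) auto
qed

text \<open>If nowhere dense sets \<open>N j\<close> covered the family, a member missing infinitely
  many blocks could be enlarged there by patterns that expel it from every \<open>N j\<close>, yet
  upward closure keeps it in the family.\<close>

lemma misses_intervals_imp_not_meager:
  assumes F: "misses_intervals \<F>" and up: "\<And>A B. \<lbrakk>A \<in> \<F>; A \<subseteq> B\<rbrakk> \<Longrightarrow> B \<in> \<F>"
  shows "\<not> meager_in powerset_topology \<F>"
proof
  assume "meager_in powerset_topology \<F>"
  then obtain N :: "nat \<Rightarrow> nat set set" where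
    N: "\<And>j. nowhere_dense_in powerset_topology (N j)" and FN: "\<F> = (\<Union>j. N j)"
    unfolding meager_in_def by auto
  have "\<forall>n. \<exists>m t. n < m \<and> t \<subseteq> {n..<m} \<and> (\<forall>j\<le>n. \<forall>A. A \<inter> {n..<m} = t \<longrightarrow> A \<notin> N j)"
    using nowhere_dense_uniform_block[OF N] by (rule allI)
  from choice[OF this] obtain m where
    "\<forall>n. \<exists>t. n < m n \<and> t \<subseteq> {n..<m n} \<and> (\<forall>j\<le>n. \<forall>A. A \<inter> {n..<m n} = t \<longrightarrow> A \<notin> N j)" ..
  from choice[OF this] obtain t where
    t: "\<forall>n. n < m n \<and> t n \<subseteq> {n..<m n} \<and> (\<forall>j\<le>n. \<forall>A. A \<inter> {n..<m n} = t n \<longrightarrow> A \<notin> N j)" ..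
  then have mt: "\<And>n. n < m n" "\<And>n. t n \<subseteq> {n..<m n}"
    "\<And>n A j. \<lbrakk>j \<le> n; A \<inter> {n..<m n} = t n\<rbrakk> \<Longrightarrow> A \<notin> N j"
    by simp_all
  \<comment> \<open>Iterating \<open>m\<close> makes \<open>{k i..<k (Suc i)}\<close> exactly the
    block that carries the pattern \<open>t (k i)\<close>.\<close>
  define k where "k i = (m ^^ i) 0" for i
  have k_Suc: "k (Suc i) = m (k i)" for i by (simp add: k_def)
  have k: "strict_mono k" by (simp add: strict_mono_Suc_iff k_Suc mt)
  then obtain A where A: "A \<in> \<F>" "infinite {i. A \<inter> {k i..<k (Suc i)} = {}}"
    using F unfolding misses_intervals_def by blast
  let ?I = "{i. A \<inter> {k i..<k (Suc i)} = {}}"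
  define B where "B = A \<union> (\<Union>i\<in>?I. t (k i))"
  have "B \<in> \<F>" using up[OF A(1)] unfolding B_def by blast
  then obtain j where j: "B \<in> N j" using FN by blast
  obtain i where i: "i \<in> ?I" "j \<le> i"
    using A(2) by (meson infinite_nat_iff_unbounded_le)
  \<comment> \<open>Blocks are disjoint, so no other pattern interferes and \<open>B\<close> shows
    exactly \<open>t (k i)\<close> on a block missed by \<open>A\<close>.\<close>
  have "n \<in> t (k i)" if "n \<in> t (k i')" "k i \<le> n" "n < k (Suc i)" for n i'
  proof -
    have "k i' \<le> n" "n < k (Suc i')" using mt(2)[of "k i'"] that(1) k_Suc by auto
    then have "k i' < k (Suc i)" "k i < k (Suc i')" using that by auto
    then have "i' = i" using k by (simp add: strict_mono_less)
    then show ?thesis using that by simp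
  qed
  then have "B \<inter> {k i..<m (k i)} = t (k i)"
    using i(1) mt(2)[of "k i"] unfolding B_def k_Suc by fastforce
  moreover have "j \<le> k i" using i(2) strict_mono_imp_increasing[OF k, of i] by simp
  ultimately show False using mt(3) j by blast
qed

section \<open>Crowded families of cofinite sets are not closed in the filter\<close>

lemma crowded_cofinite_not_closed:
  assumes F: "misses_intervals (filter_sets F)" and free: "free_filter F"
    and Q: "Q \<subseteq> {A. finite (- A)}" "Q \<noteq> {}"
    and crowded: "Q \<subseteq> subtopology powerset_topology (filter_sets F) derived_set_of Q"
  shows "\<not> closedin (subtopology powerset_topology (filter_sets F)) Q"
proof
  assume closed: "closedin (subtopology powerset_topology (filter_sets F)) Q"
  \<comment> \<open>Crowdedness supplies a move inside \<open>Q\<close> that leaves everything below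
    \<open>n\<close> fixed.\<close>
  define nx where "nx q n = (SOME q'. q' \<in> Q \<and> q' \<noteq> q \<and> q' \<inter> {..<n} = q \<inter> {..<n})" for q and n :: nat
  have nx: "nx q n \<in> Q" "nx q n \<noteq> q" "nx q n \<inter> {..<n} = q \<inter> {..<n}" if "q \<in> Q" for q n
  proof -
    have "q \<in> subtopology powerset_topology (filter_sets F) derived_set_of Q"
      using crowded that by blast
    then have "\<exists>q'. q' \<in> Q \<and> q' \<noteq> q \<and> q' \<inter> {..<n} = q \<inter> {..<n}"
      unfolding in_derived_set_of_subtopology_powerset by blast
    from someI_ex[OF this] show "nx q n \<in> Q" "nx q n \<noteq> q" "nx q n \<inter> {..<n} = q \<inter> {..<n}"
      by (simp_all add: nx_def)
  qed
  \<comment> \<open>Only finitely many \<open>q\<close> contain \<open>{n..}\<close>, so one bound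
    serves all. This uniformity lets the partition be fixed before \<open>A\<close>, on which the
    path of moves depends.\<close>
  have "\<exists>m>n. \<forall>q\<in>Q. {n..} \<subseteq> q \<longrightarrow> {m..} \<subseteq> nx q n" for n
  proof -
    let ?S = "{q \<in> Q. {n..} \<subseteq> q}"
    have "?S \<subseteq> uminus ` Pow {..<n}"
    proof
      fix q assume "q \<in> ?S"
      then have "- q \<subseteq> - {n..}" by blast
      then have "- q \<in> Pow {..<n}" unfolding Compl_atLeast by (rule PowI)
      then show "q \<in> uminus ` Pow {..<n}" by (rule rev_image_eqI) simp
    qed
    then have "finite ?S" by (rule finite_subset) simp
    then have "finite (\<Union>q\<in>?S. - nx q n)" using nx(1) Q(1) by blast
    then obtain m where m: "(\<Union>q\<in>?S. - nx q n) \<subseteq> {..<m}"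
      by (auto simp: finite_nat_iff_bounded)
    have "x \<in> nx q n" if "q \<in> Q" "{n..} \<subseteq> q" "m \<le> x" for q x
    proof (rule ccontr)
      assume "x \<notin> nx q n"
      then have "x \<in> {..<m}" using m that(1,2) by blast
      then show False using that(3) by simp
    qed
    then show ?thesis
      by (intro exI[of _ "max (Suc n) m"]) auto
  qed
  then have "\<forall>n. \<exists>m>n. \<forall>q\<in>Q. {n..} \<subseteq> q \<longrightarrow> {m..} \<subseteq> nx q n" by (rule allI)
  from choice[OF this] obtain f where
    f': "\<forall>n. n < f n \<and> (\<forall>q\<in>Q. {n..} \<subseteq> q \<longrightarrow> {f n..} \<subseteq> nx q n)" ..
  then have f: "\<And>n. n < f n" "\<And>n q. \<lbrakk>q \<in> Q; {n..} \<subseteq> q\<rbrakk> \<Longrightarrow> {f n..} \<subseteq> nx q n"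
    by blast+
  obtain q0 where q0: "q0 \<in> Q" using Q(2) by blast
  then have "finite (- q0)" using Q(1) by blast
  then obtain k0 where k0: "- q0 \<subseteq> {..<k0}"
    by (auto simp: finite_nat_iff_bounded)
  define k where "k i = (f ^^ i) k0" for i
  have k_Suc: "k (Suc i) = f (k i)" for i by (simp add: k_def)
  have k: "strict_mono k" by (simp add: strict_mono_Suc_iff k_Suc f)
  then obtain A where A: "A \<in> filter_sets F" "infinite {i. A \<inter> {k i..<k (Suc i)} = {}}"
    using F unfolding misses_intervals_def by blast
  define I where "I = {i. A \<inter> {k i..<k (Suc i)} = {}}"
  \<comment> \<open>The path moves only at intervals missed by \<open>A\<close>. Each
    \<open>p i\<close> is full from \<open>k i\<close> on, so a move at stage \<open>i\<close> takes
    effect inside interval \<open>i\<close> alone.\<close>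
  define p where "p = rec_nat q0 (\<lambda>i q. if i \<in> I then nx q (k i) else q)"
  have p_0: "p 0 = q0" and p_Suc: "p (Suc i) = (if i \<in> I then nx (p i) (k i) else p i)" for i
    by (simp_all add: p_def)
  have p: "p i \<in> Q \<and> {k i..} \<subseteq> p i" for i
  proof (induction i)
    case 0
    then show ?case using q0 k0 by (auto simp: p_0 k_def)
  next
    case (Suc i)
    then show ?case
      using nx(1) f(2)[of "p i" "k i"] f(1)[of "k i"] by (auto simp: p_Suc k_Suc)
  qed
  have p_agree: "n \<in> p j \<longleftrightarrow> n \<in> p i" if "i \<le> j" "n < k i" for i j n
    using that
  proof (induction j rule: dec_induct)
    case (step j)
    then have "n < k j" using strict_mono_less_eq[OF k, of i j] by simp
    then have "n \<in> p (Suc j) \<longleftrightarrow> n \<in> p j" using nx(3)[of "p j" "k j"] p by (auto simp: p_Suc)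
    then show ?case using step by simp
  qed simp
  \<comment> \<open>The pointwise limit of the path: since \<open>n < k (Suc n)\<close>, membership
    of \<open>n\<close> is settled from stage \<open>Suc n\<close> on.\<close>
  define B where "B = {n. n \<in> p (Suc n)}"
  have B: "n \<in> B \<longleftrightarrow> n \<in> p i" if "n < k i" for i n
  proof -
    have "n < k (Suc n)" using strict_mono_imp_increasing[OF k, of "Suc n"] by simp
    then show ?thesis
      unfolding B_def using p_agree[of i "Suc n" n] p_agree[of "Suc n" i n] that
      by (cases "i \<le> Suc n") auto
  qed
  \<comment> \<open>An element of \<open>A\<close> past \<open>k0\<close> lies in an interval where
    the path stands still, and there \<open>p i\<close> is full.\<close>
  have "A \<inter> {k0..} \<subseteq> B"
  proof
    fix n assume n: "n \<in> A \<inter> {k0..}"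
    then obtain i where i: "k i \<le> n" "n < k (Suc i)"
      using strict_mono_between[OF k, of n] by (auto simp: k_def)
    then have "i \<notin> I" using n by (auto simp: I_def)
    then have "n \<in> p (Suc i)" using p[of i] i by (auto simp: p_Suc)
    then show "n \<in> B" using B i by blast
  qed
  moreover have "A \<inter> {k0..} \<in> filter_sets F"
  proof -
    have "finite (- {k0..})" by (simp add: Compl_atLeast)
    then have "{k0..} \<in> filter_sets F" using free unfolding free_filter_def by blast
    with A(1) show ?thesis by (auto simp: filter_sets_def intro: eventually_conj)
  qed
  ultimately have "B \<in> filter_sets F"
    unfolding filter_sets_def by (auto elim: eventually_mono)
  moreover have "\<exists>C\<in>Q \<inter> filter_sets F. C \<inter> {..<n} = B \<inter> {..<n}" for n
  proof (rule bexI[of _ "p n"])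
    show "p n \<in> Q \<inter> filter_sets F"
      using p closedin_subset[OF closed] by auto
    have "n \<le> k n" by (rule strict_mono_imp_increasing[OF k])
    then show "p n \<inter> {..<n} = B \<inter> {..<n}" using B[of _ n] by auto
  qed
  ultimately have "B \<in> subtopology powerset_topology (filter_sets F) closure_of Q"
    by (auto simp: in_closure_of_subtopology_powerset)
  then have "finite (- B)" using closed Q(1) by (auto simp: closure_of_closedin)
  then obtain b where b: "- B \<subseteq> {..<b}" by (auto simp: finite_nat_iff_bounded)
  \<comment> \<open>The move at stage \<open>i\<close> must drop some \<open>n\<close> in interval
    \<open>i\<close>, as \<open>p i\<close> is full from \<open>k i\<close> on. This
    \<open>n \<ge> b\<close> never returns, although \<open>B\<close> should contain everything from
    \<open>b\<close> on.\<close>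
  obtain i where i: "i \<in> I" "b \<le> i"
    using A(2) unfolding I_def by (meson infinite_nat_iff_unbounded_le)
  have "p (Suc i) \<noteq> p i" "p (Suc i) \<inter> {..<k i} = p i \<inter> {..<k i}"
    using nx(2,3) p i by (auto simp: p_Suc)
  then obtain n where n: "n \<in> p (Suc i) \<longleftrightarrow> n \<notin> p i" and "n \<notin> {..<k i}"
    by blast
  then have n_ge: "k i \<le> n" by simp
  then have n_out: "n \<notin> p (Suc i)" using p[of i] n by auto
  have "n < k (Suc i)"
  proof (rule ccontr)
    assume "\<not> n < k (Suc i)"
    then have "n \<in> p (Suc i)" using p[of "Suc i"] by auto
    with n_out show False ..
  qed
  then have "n \<notin> B" using B n_out by blast
  then show False using b n_ge i(2) strict_mono_imp_increasing[OF k, of i] by auto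
qed

section \<open>The filter\<close>

text \<open>Finer filters are smaller in the library order, so Zorn's lemma is applied to the
  reversed order and yields a minimal proper filter below \<open>F\<close>.\<close>

lemma ex_ultrafilter_le:
  fixes F :: "'a filter"
  assumes "F \<noteq> bot"
  obtains U where "U \<noteq> bot" "U \<le> F"
    "\<And>P. eventually P U \<or> eventually (\<lambda>x. \<not> P x) U"
proof -
  let ?A = "{G. G \<noteq> bot \<and> G \<le> F}"
  let ?R = "relation_of (\<lambda>G H :: 'a filter. H \<le> G) ?A"
  have "\<exists>U\<in>?A. \<forall>G\<in>?A. G \<le> U \<longrightarrow> G = U"
  proof (rule predicate_Zorn)
    show "partial_order_on ?A ?R"
      by (rule partial_order_on_relation_ofI) auto
  next
    fix C assume C: "C \<in> Chains ?R"
    then have CA: "C \<subseteq> ?A" by (auto simp: Chains_def relation_of_def)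
    show "\<exists>u\<in>?A. \<forall>a\<in>C. u \<le> a"
    proof (cases "C = {}")
      case True
      then show ?thesis using assms by auto
    next
      case False
      \<comment> \<open>For a nonempty chain, an event of the infimum is already an event of one
        member; hence the infimum is proper.\<close>
      have "eventually P (Inf C) \<longleftrightarrow> (\<exists>G\<in>C. eventually P G)" for P
      proof (rule eventually_Inf_base[OF False])
        fix G H assume "G \<in> C" "H \<in> C"
        then have "G \<le> H \<or> H \<le> G" using C by (auto simp: Chains_def relation_of_def)
        then show "\<exists>x\<in>C. x \<le> inf G H" using \<open>G \<in> C\<close> \<open>H \<in> C\<close> by auto
      qed
      then have "Inf C \<noteq> bot" using CA by (auto simp: trivial_limit_def)
      moreover have "Inf C \<le> F"
        using False CA by (auto intro: Inf_lower2)
      ultimately show ?thesis by (auto intro: Inf_lower)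
    qed
  qed
  then obtain U where U: "U \<noteq> bot" "U \<le> F" "\<And>G. \<lbrakk>G \<noteq> bot; G \<le> U\<rbrakk> \<Longrightarrow> G = U"
    by (auto intro: order_trans)
  have "eventually P U" if "\<not> eventually (\<lambda>x. \<not> P x) U" for P
  proof -
    \<comment> \<open>Restricting \<open>U\<close> to \<open>P\<close> leaves a proper filter, which
      minimality identifies with \<open>U\<close>.\<close>
    have "inf U (principal {x. P x}) \<noteq> bot"
      using that by (auto simp: trivial_limit_def eventually_inf_principal)
    then have "inf U (principal {x. P x}) = U" by (intro U(3)) auto
    moreover have "eventually P (inf U (principal {x. P x}))"
      by (simp add: eventually_inf_principal)
    ultimately show ?thesis by simp
  qed
  then show ?thesis using that U by blast
qed

text \<open>The union of the even-numbered intervals misses the odd-numbered ones, its complement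
  misses the even-numbered ones, and one of the two sets lies in \<open>U\<close>.\<close>

lemma ultrafilter_misses_intervals:
  assumes ultra: "\<And>P. eventually P U \<or> eventually (\<lambda>x. \<not> P x) U"
  shows "misses_intervals (filter_sets U)"
  unfolding misses_intervals_def
proof (intro allI impI)
  fix k :: "nat \<Rightarrow> nat" assume k: "strict_mono k"
  define E where "E = (\<Union>i\<in>{i. even i}. {k i..<k (Suc i)})"
  have E: "n \<in> E \<longleftrightarrow> even i" if "n \<in> {k i..<k (Suc i)}" for n i
  proof -
    have "i = i'" if "n \<in> {k i'..<k (Suc i')}" for i'
    proof -
      have "k i' < k (Suc i)" "k i < k (Suc i')"
        using that \<open>n \<in> {k i..<k (Suc i)}\<close> by auto
      then show ?thesis using k by (simp add: strict_mono_less)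
    qed
    then show ?thesis using that unfolding E_def by blast
  qed
  have "infinite (range (\<lambda>i::nat. 2 * i))" "infinite (range (\<lambda>i::nat. 2 * i + 1))"
    by (auto intro!: range_inj_infinite injI)
  moreover have "range (\<lambda>i. 2 * i + 1) \<subseteq> {i. E \<inter> {k i..<k (Suc i)} = {}}"
    "range (\<lambda>i. 2 * i) \<subseteq> {i. (- E) \<inter> {k i..<k (Suc i)} = {}}"
    using E by fastforce+
  ultimately have "infinite {i. E \<inter> {k i..<k (Suc i)} = {}}"
    "infinite {i. (- E) \<inter> {k i..<k (Suc i)} = {}}"
    using infinite_super by blast+
  moreover have "E \<in> filter_sets U \<or> - E \<in> filter_sets U"
    using ultra[of "\<lambda>x. x \<in> E"] by (simp add: filter_sets_def)
  ultimately show "\<exists>A\<in>filter_sets U. infinite {i. A \<inter> {k i..<k (Suc i)} = {}}" by blast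
qed

section \<open>The product of the cofinite filter with \<open>U\<close>\<close>

text \<open>The Fubini product of the Frechet filter with \<open>U\<close>, carried from pairs to
  the naturals by the pairing function.\<close>

definition cofinite_times :: "nat filter \<Rightarrow> nat filter" where
  "cofinite_times U =
     Abs_filter (\<lambda>P. \<forall>\<^sub>F n in cofinite. \<forall>\<^sub>F m in U. P (prod_encode (n, m)))"

lemma eventually_cofinite_times:
  "eventually P (cofinite_times U) \<longleftrightarrow>
     (\<forall>\<^sub>F n in cofinite. \<forall>\<^sub>F m in U. P (prod_encode (n, m)))"
  unfolding cofinite_times_def
proof (rule eventually_Abs_filter, unfold_locales)
  fix P Q :: "nat \<Rightarrow> bool"
  assume "\<forall>\<^sub>F n in cofinite. \<forall>\<^sub>F m in U. P (prod_encode (n, m))"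
    "\<forall>\<^sub>F n in cofinite. \<forall>\<^sub>F m in U. Q (prod_encode (n, m))"
  then show "\<forall>\<^sub>F n in cofinite. \<forall>\<^sub>F m in U. P (prod_encode (n, m)) \<and> Q (prod_encode (n, m))"
    by eventually_elim (rule eventually_conj)
next
  fix P Q :: "nat \<Rightarrow> bool"
  assume "\<forall>x. P x \<longrightarrow> Q x" "\<forall>\<^sub>F n in cofinite. \<forall>\<^sub>F m in U. P (prod_encode (n, m))"
  then show "\<forall>\<^sub>F n in cofinite. \<forall>\<^sub>F m in U. Q (prod_encode (n, m))"
    by (auto elim!: eventually_mono)
qed simp

lemma in_filter_sets_cofinite_times:
  "A \<in> filter_sets (cofinite_times U) \<longleftrightarrow>
     (\<forall>\<^sub>F n in cofinite. \<forall>\<^sub>F m in U. prod_encode (n, m) \<in> A)"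
  by (simp add: filter_sets_def eventually_cofinite_times)

lemma free_filter_cofinite_times:
  assumes "U \<noteq> bot" "U \<le> cofinite"
  shows "free_filter (cofinite_times U)"
  unfolding free_filter_def
proof (intro conjI allI impI)
  show "cofinite_times U \<noteq> bot"
    using assms(1) by (simp add: trivial_limit_def eventually_cofinite_times)
next
  fix A :: "nat set" assume "finite (- A)"
  have "\<forall>\<^sub>F m in U. prod_encode (n, m) \<in> A" for n
  proof -
    have "finite ((\<lambda>m. prod_encode (n, m)) -` (- A))"
      by (rule finite_vimageI[OF \<open>finite (- A)\<close>]) (auto simp: inj_on_def)
    then have "\<forall>\<^sub>F m in cofinite. prod_encode (n, m) \<in> A"
      by (simp add: eventually_cofinite vimage_def)
    with assms(2) show ?thesis by (rule filter_leD)
  qed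
  then show "A \<in> filter_sets (cofinite_times U)"
    by (simp add: in_filter_sets_cofinite_times)
qed

text \<open>One set \<open>Z\<close> from \<open>U\<close> serves in every section. It is chosen for
  a coarser partition \<open>l\<close>, so that each \<open>l\<close>-interval missed by
  \<open>Z\<close> provides a \<open>k\<close>-interval missed by the codes.\<close>

lemma misses_intervals_cofinite_times:
  assumes U: "misses_intervals (filter_sets U)" and le: "U \<le> cofinite"
  shows "misses_intervals (filter_sets (cofinite_times U))"
  unfolding misses_intervals_def
proof (intro allI impI)
  fix k :: "nat \<Rightarrow> nat" assume k: "strict_mono k"
  have "\<exists>N\<ge>n. \<forall>a<n. \<forall>b<n. prod_encode (a, b) < N" for n
  proof -
    have "finite (prod_encode ` ({..<n} \<times> {..<n}))" by simp
    then obtain N where "prod_encode ` ({..<n} \<times> {..<n}) \<subseteq> {..<N}"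
      by (auto simp: finite_nat_iff_bounded)
    then show ?thesis by (intro exI[of _ "max n N"]) (force simp: less_max_iff_disj)
  qed
  then obtain N where N: "\<And>n. n \<le> N n"
    "\<And>n a b. \<lbrakk>a < n; b < n\<rbrakk> \<Longrightarrow> prod_encode (a, b) < N n" by metis
  \<comment> \<open>The \<open>k\<close>-interval numbered \<open>N (l j)\<close> ends at
    \<open>l (Suc j)\<close> and starts above all codes of pairs below \<open>l j\<close>.\<close>
  define l where "l j = ((\<lambda>n. k (Suc (N n))) ^^ j) 0" for j
  have l_Suc: "l (Suc j) = k (Suc (N (l j)))" for j by (simp add: l_def)
  have "l j < l (Suc j)" for j
    using N(1)[of "l j"] strict_mono_imp_increasing[OF k, of "Suc (N (l j))"] by (simp add: l_Suc)
  then have l: "strict_mono l" by (simp add: strict_mono_Suc_iff)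
  then obtain Z where Z: "Z \<in> filter_sets U" "infinite {j. Z \<inter> {l j..<l (Suc j)} = {}}"
    using U unfolding misses_intervals_def by blast
  \<comment> \<open>Requiring \<open>n \<le> m\<close> removes finitely many points from each
    section, and a bound on \<open>m\<close> then bounds both coordinates.\<close>
  define A where "A = {c. \<exists>n m. c = prod_encode (n, m) \<and> n \<le> m \<and> m \<in> Z}"
  have "\<forall>\<^sub>F m in U. prod_encode (n, m) \<in> A" for n
  proof -
    have "\<forall>\<^sub>F m in cofinite. n \<le> m"
      by (simp add: eventually_cofinite not_le)
    then have "\<forall>\<^sub>F m in U. n \<le> m" using le filter_leD by blast
    moreover have "\<forall>\<^sub>F m in U. m \<in> Z" using Z(1) by (simp add: filter_sets_def)
    ultimately show ?thesis by eventually_elim (auto simp: A_def)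
  qed
  then have "A \<in> filter_sets (cofinite_times U)"
    by (simp add: in_filter_sets_cofinite_times)
  moreover have "infinite {i. A \<inter> {k i..<k (Suc i)} = {}}"
    unfolding infinite_nat_iff_unbounded_le
  proof
    fix b
    obtain j where j: "b \<le> j" "Z \<inter> {l j..<l (Suc j)} = {}"
      using Z(2) unfolding infinite_nat_iff_unbounded_le by blast
    let ?i = "N (l j)"
    \<comment> \<open>The second coordinate \<open>m\<close> is at most \<open>c\<close>, hence
      below \<open>l (Suc j)\<close>; if \<open>m < l j\<close>, the code would be too small. So
      \<open>m\<close> falls in an interval missed by \<open>Z\<close>.\<close>
    have "False" if "c \<in> A" "k ?i \<le> c" "c < k (Suc ?i)" for c
    proof -
      obtain n m where c: "c = prod_encode (n, m)" "n \<le> m" "m \<in> Z"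
        using \<open>c \<in> A\<close> by (auto simp: A_def)
      have "m < l (Suc j)"
        using le_prod_encode_2[of m n] that(3) c(1) by (simp add: l_Suc)
      moreover have "l j \<le> m"
      proof (rule ccontr)
        assume "\<not> l j \<le> m"
        then have "c < ?i" using N(2)[of n "l j" m] c by simp
        then show False using that(2) strict_mono_imp_increasing[OF k, of ?i] by simp
      qed
      ultimately show False using j(2) c(3) by auto
    qed
    moreover have "b \<le> ?i"
      using j(1) N(1)[of "l j"] strict_mono_imp_increasing[OF l, of j] by simp
    ultimately show "\<exists>i\<ge>b. i \<in> {i. A \<inter> {k i..<k (Suc i)} = {}}"
      by (intro exI[of _ ?i]) auto
  qed
  ultimately show "\<exists>A\<in>filter_sets (cofinite_times U). infinite {i. A \<inter> {k i..<k (Suc i)} = {}}"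
    by blast
qed

section \<open>A crowded set closed in the filter\<close>

definition cofinite_cylinders :: "nat set set" where
  "cofinite_cylinders = (\<lambda>y. {c. fst (prod_decode c) \<in> y}) ` {y. finite (- y)}"

lemma cofinite_cylinders_subset:
  "cofinite_cylinders \<subseteq> filter_sets (cofinite_times U)"
proof
  fix A assume "A \<in> cofinite_cylinders"
  then obtain y where y: "finite (- y)" "A = {c. fst (prod_decode c) \<in> y}"
    by (auto simp: cofinite_cylinders_def)
  have "\<forall>\<^sub>F n in cofinite. n \<in> y"
    using y(1) by (simp add: eventually_cofinite Compl_eq)
  then show "A \<in> filter_sets (cofinite_times U)"
    unfolding in_filter_sets_cofinite_times y(2) by eventually_elim simp
qed

text \<open>A limit of sets \<open>y\<close> x omega again has that form. Its sections are full or
  empty, and as \<open>U\<close> is proper, lying in the filter forces \<open>y\<close> to be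
  cofinite.\<close>

lemma closedin_cofinite_cylinders:
  assumes "U \<noteq> bot"
  shows "closedin (subtopology powerset_topology (filter_sets (cofinite_times U))) cofinite_cylinders"
proof -
  let ?F = "filter_sets (cofinite_times U)"
  have "A \<in> cofinite_cylinders"
    if A: "A \<in> ?F" and near: "\<And>n. \<exists>B\<in>cofinite_cylinders. B \<inter> {..<n} = A \<inter> {..<n}" for A
  proof -
    define y where "y = {n. prod_encode (n, 0) \<in> A}"
    have Ay: "c \<in> A \<longleftrightarrow> fst (prod_decode c) \<in> y" for c
    proof -
      let ?c = "prod_encode (fst (prod_decode c), 0)"
      \<comment> \<open>\<open>n\<close> exceeds both codes, so \<open>A\<close> inherits from
        \<open>B\<close> that they are both in or both out.\<close>
      obtain B n where B: "B \<in> cofinite_cylinders" "B \<inter> {..<n} = A \<inter> {..<n}"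
        and n: "c < n" "?c < n"
        using near[of "Suc (max c ?c)"] by (meson less_Suc_eq_le max.cobounded1 max.cobounded2)
      have "c \<in> B \<longleftrightarrow> ?c \<in> B" using B(1) by (auto simp: cofinite_cylinders_def)
      moreover have "c \<in> B \<longleftrightarrow> c \<in> A" "?c \<in> B \<longleftrightarrow> ?c \<in> A"
        using B(2) n by blast+
      ultimately show ?thesis unfolding y_def by blast
    qed
    have "\<forall>\<^sub>F n in cofinite. n \<in> y"
      using A assms by (simp add: in_filter_sets_cofinite_times Ay)
    then have "finite (- y)" by (simp add: eventually_cofinite Compl_eq)
    then show ?thesis using Ay by (auto simp: cofinite_cylinders_def)
  qed
  then have "subtopology powerset_topology ?F closure_of cofinite_cylinders \<subseteq> cofinite_cylinders"
    by (simp add: subset_iff in_closure_of_subtopology_powerset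
        Int_absorb2[OF cofinite_cylinders_subset])
  then show ?thesis
    using cofinite_cylinders_subset[of U] closure_of_subset_eq[of cofinite_cylinders "subtopology powerset_topology ?F"]
    by simp
qed

lemma crowded_cofinite_cylinders:
  "cofinite_cylinders \<subseteq>
     subtopology powerset_topology (filter_sets (cofinite_times U)) derived_set_of cofinite_cylinders"
proof
  fix A assume A: "A \<in> cofinite_cylinders"
  then obtain y where y: "finite (- y)" "A = {c. fst (prod_decode c) \<in> y}"
    by (auto simp: cofinite_cylinders_def)
  have "\<exists>B\<in>cofinite_cylinders. B \<noteq> A \<and> B \<inter> {..<n} = A \<inter> {..<n}" for n
  proof -
    \<comment> \<open>Flipping \<open>y\<close> at \<open>n\<close> affects only codes with first
      coordinate \<open>n\<close>, and these are at least \<open>n\<close>.\<close>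
    define y' where "y' = (if n \<in> y then y - {n} else insert n y)"
    have "- y' \<subseteq> insert n (- y)" by (auto simp: y'_def)
    then have "finite (- y')" using y(1) finite_subset by blast
    moreover have "{c. fst (prod_decode c) \<in> y'} \<noteq> A"
    proof -
      have "prod_encode (n, 0) \<in> {c. fst (prod_decode c) \<in> y'} \<longleftrightarrow> prod_encode (n, 0) \<notin> A"
        by (simp add: y(2) y'_def)
      then show ?thesis by blast
    qed
    moreover have "fst (prod_decode c) \<noteq> n" if "c < n" for c
      using le_prod_encode_1[of "fst (prod_decode c)" "snd (prod_decode c)"] that by simp
    then have "{c. fst (prod_decode c) \<in> y'} \<inter> {..<n} = A \<inter> {..<n}"
      by (auto simp: y(2) y'_def)
    ultimately show ?thesis by (auto simp: cofinite_cylinders_def)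
  qed
  then show "A \<in> subtopology powerset_topology (filter_sets (cofinite_times U))
      derived_set_of cofinite_cylinders"
    using A cofinite_cylinders_subset[of U]
    by (simp add: in_derived_set_of_subtopology_powerset subset_iff
        Int_absorb2[OF cofinite_cylinders_subset])
qed

section \<open>Two countable dense sets\<close>

lemma countable_cofinite_sets: "countable {A :: 'a :: countable set. finite (- A)}"
proof -
  have "{A :: 'a set. finite (- A)} \<subseteq> uminus ` {A. finite A}"
    by (auto intro: rev_image_eqI[of "- A" for A])
  then show ?thesis by (rule countable_subset) (simp add: countable_Collect_finite)
qed

text \<open>Any \<open>A\<close> agrees below \<open>n\<close> with the cofinite set
  \<open>A \<union> {n..}\<close>, which freeness puts into the filter.\<close>

lemma countable_dense_cofinite_sets:
  assumes "free_filter F"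
  shows "countable_dense_in (subtopology powerset_topology (filter_sets F)) {A. finite (- A)}"
proof -
  have sub: "{A. finite (- A)} \<subseteq> filter_sets F"
    using assms by (auto simp: free_filter_def)
  have "\<exists>B\<in>{A. finite (- A)} \<inter> filter_sets F. B \<inter> {..<n} = A \<inter> {..<n}" for A n
  proof -
    have "finite (- (A \<union> {n..}))"
      by (rule finite_subset[of _ "{..<n}"]) auto
    moreover have "(A \<union> {n..}) \<inter> {..<n} = A \<inter> {..<n}" by auto
    ultimately show ?thesis using sub by blast
  qed
  then show ?thesis
    using sub countable_cofinite_sets
    by (auto simp: countable_dense_in_def in_closure_of_subtopology_powerset)
qed

theorem theorem1:
  shows "\<exists>F :: nat filter.
           free_filter F \<and>
           \<not> meager_in powerset_topology (filter_sets F) \<and>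
           \<not> CDH_space (subtopology powerset_topology (filter_sets F))"
proof -
  \<comment> \<open>On the naturals \<open>cofinite\<close> equals \<open>sequentially\<close>,
    which is proper.\<close>
  obtain U :: "nat filter" where U: "U \<noteq> bot" "U \<le> cofinite"
    "\<And>P. eventually P U \<or> eventually (\<lambda>x. \<not> P x) U"
    using ex_ultrafilter_le[of "cofinite :: nat filter"] by (auto simp: cofinite_eq_sequentially)
  define F where "F = cofinite_times U"
  let ?X = "subtopology powerset_topology (filter_sets F)"
  let ?D0 = "{A :: nat set. finite (- A)}"
  let ?D1 = "?D0 \<union> cofinite_cylinders"
  have free: "free_filter F"
    unfolding F_def using U by (intro free_filter_cofinite_times)
  have misses: "misses_intervals (filter_sets F)"
    unfolding F_def using U by (intro misses_intervals_cofinite_times ultrafilter_misses_intervals)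
  have "\<not> meager_in powerset_topology (filter_sets F)"
    using misses by (rule misses_intervals_imp_not_meager)
      (auto simp: filter_sets_def elim: eventually_mono)
  moreover have "\<not> CDH_space ?X"
  proof
    assume CDH: "CDH_space ?X"
    have D0: "countable_dense_in ?X ?D0"
      using free by (rule countable_dense_cofinite_sets)
    have "?X closure_of ?D0 \<subseteq> ?X closure_of ?D1" by (rule closure_of_mono) simp
    moreover have "countable cofinite_cylinders"
      unfolding cofinite_cylinders_def using countable_cofinite_sets by (rule countable_image)
    ultimately have "countable_dense_in ?X ?D1"
      using D0 cofinite_cylinders_subset[of U] closure_of_subset_topspace[of ?X ?D1]
      by (auto simp: countable_dense_in_def F_def)
    with CDH D0 obtain \<phi> where \<phi>: "homeomorphic_map ?X ?X \<phi>" "\<phi> ` ?D1 = ?D0"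
      unfolding CDH_space_def by blast
    have sub: "cofinite_cylinders \<subseteq> topspace ?X"
      using cofinite_cylinders_subset[of U] by (simp add: F_def)
    \<comment> \<open>Homeomorphisms preserve closed and crowded sets, and \<open>\<phi>\<close>
      sends the cylinders into the cofinite sets.\<close>
    have "closedin ?X (\<phi> ` cofinite_cylinders)"
      using homeomorphic_map_closedness[OF \<phi>(1) sub] closedin_cofinite_cylinders[OF U(1)]
      by (simp add: F_def)
    moreover have "\<phi> ` cofinite_cylinders \<subseteq> ?X derived_set_of (\<phi> ` cofinite_cylinders)"
      using homeomorphic_map_derived_set_of[OF \<phi>(1) sub] crowded_cofinite_cylinders[of U]
      by (auto simp: F_def)
    moreover have "cofinite_cylinders \<noteq> {}"
      by (auto simp: cofinite_cylinders_def intro: exI[of _ UNIV])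
    ultimately show False
      using crowded_cofinite_not_closed[OF misses free, of "\<phi> ` cofinite_cylinders"] \<phi>(2)
      by blast
  qed
  ultimately show ?thesis using free by blast
qed

end
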